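(* Let $\mathcal{E}$ be a Hilbert $K(\mathcal{H})$-module and let $x, y \in \mathcal{E}$. Then the following statements are equivalent: (i) $x \| y$; (ii) $\lambda\| x\|\| y\|$ is an eigenvalue of $\langle x , y \rangle$ for some $\lambda \in \mathbb{T}$.
   Context: $(\mathcal{H}, [\cdot,\cdot])$ is a complex Hilbert space and $K(\mathcal{H})$ is the $C^*$-algebra of compact linear operators on $\mathcal{H}$. A (left) Hilbert $\mathcal{A}$-module over a $C^*$-algebra $\mathcal{A}$ is a left $\mathcal{A}$-module with an $\mathcal{A}$-valued inner product $\langle\cdot,\cdot\rangle$, linear in the first variable and conjugate linear in the second, such that $\langle tx,y\rangle=t\langle x,y\rangle$ for $t\in\mathcal{A}$, $\langle x,y\rangle^*=\langle y,x\rangle$, $\langle x,x\rangle\ge 0$ with equality iff $x=0$, and which is complete for the norm $\|x\|=\|\langle x,x\rangle\|^{1/2}$. Norm-parallelism: for elements $x,y$ of a complex normed space, $x\|y$ means $\|x+\lambda y\|=\|x\|+\|y\|$ for some $\lambda\in\mathbb{T}=\{\alpha\in\mathbb{C}:|\alpha|=1\}$. *)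

theory Defs
  imports "HOL-Analysis.Analysis"
begin

class complex_vector = real_vector +
  fixes scaleC :: "complex \<Rightarrow> 'a \<Rightarrow> 'a" (infixr "*\<^sub>C" 75)
  assumes scaleC_add_right: "c *\<^sub>C (x + y) = c *\<^sub>C x + c *\<^sub>C y"
    and scaleC_add_left: "(c + d) *\<^sub>C x = c *\<^sub>C x + d *\<^sub>C x"
    and scaleC_scaleC: "c *\<^sub>C d *\<^sub>C x = (c * d) *\<^sub>C x"
    and scaleC_one: "1 *\<^sub>C x = x"
    and scaleR_scaleC: "r *\<^sub>R x = complex_of_real r *\<^sub>C x"

class complex_normed_vector = complex_vector + real_normed_vector +
  assumes norm_scaleC: "norm (c *\<^sub>C x) = cmod c * norm x"

class cbanach = complex_normed_vector + complete_space

text \<open>The inner product is linear in the first and conjugate linear in the second variable.\<close>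

class complex_inner = complex_normed_vector +
  fixes cinner :: "'a \<Rightarrow> 'a \<Rightarrow> complex"
  assumes cinner_add_left: "cinner (x + y) z = cinner x z + cinner y z"
    and cinner_scaleC_left: "cinner (c *\<^sub>C x) y = c * cinner x y"
    and cinner_commute: "cinner x y = cnj (cinner y x)"
    and cinner_nonneg: "cinner x x \<in> \<real>\<^sub>\<ge>\<^sub>0"
    and cinner_eq_zero_iff: "cinner x x = 0 \<longleftrightarrow> x = 0"
    and norm_eq_sqrt_cinner: "norm x = sqrt (Re (cinner x x))"

class chilbert_space = complex_inner + complete_space

definition norm_parallel :: "'a::complex_normed_vector \<Rightarrow> 'a \<Rightarrow> bool" where
  "norm_parallel x y \<longleftrightarrow> (\<exists>c. cmod c = 1 \<and> norm (x + c *\<^sub>C y) = norm x + norm y)"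

lemma bounded_linear_scaleC: "bounded_linear (\<lambda>x::'a::complex_normed_vector. c *\<^sub>C x)"
  by (rule bounded_linear_intro[where K = "cmod c"])
    (simp_all add: scaleC_add_right scaleR_scaleC scaleC_scaleC norm_scaleC mult.commute)

text \<open>The library type of bounded operators consists of \<^emph>\<open>real\<close>-linear maps; complex linearity is
  imposed separately below. The operator norm does not depend on the scalar field.\<close>

instantiation blinfun :: (real_normed_vector, complex_normed_vector) complex_normed_vector
begin

lift_definition scaleC_blinfun :: "complex \<Rightarrow> 'a \<Rightarrow>\<^sub>L 'b \<Rightarrow> 'a \<Rightarrow>\<^sub>L 'b"
  is "\<lambda>c f x. c *\<^sub>C f x"
  by (rule bounded_linear_compose[OF bounded_linear_scaleC])

instance
proof
  fix c d :: complex and r :: real and f g :: "'a \<Rightarrow>\<^sub>L 'b"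
  show "c *\<^sub>C (f + g) = c *\<^sub>C f + c *\<^sub>C g" by transfer (simp add: scaleC_add_right)
  show "(c + d) *\<^sub>C f = c *\<^sub>C f + d *\<^sub>C f" by transfer (simp add: scaleC_add_left)
  show "c *\<^sub>C d *\<^sub>C f = (c * d) *\<^sub>C f" by transfer (simp add: scaleC_scaleC)
  show "1 *\<^sub>C f = f" by transfer (simp add: scaleC_one)
  show "r *\<^sub>R f = complex_of_real r *\<^sub>C f" by transfer (simp add: scaleR_scaleC)
  show "norm (c *\<^sub>C f) = cmod c * norm f"
  proof transfer
    fix c :: complex and f :: "'a \<Rightarrow> 'b"
    assume "bounded_linear f"
    have "onorm (\<lambda>x. c *\<^sub>C f x) = onorm (\<lambda>x. cmod c *\<^sub>R f x)"
      by (simp add: onorm_def norm_scaleC)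
    also have "\<dots> = cmod c * onorm f"
      using onorm_scaleR[OF \<open>bounded_linear f\<close>] by simp
    finally show "onorm (\<lambda>x. c *\<^sub>C f x) = cmod c * onorm f" .
  qed
qed

end

definition compact_operators :: "('h::chilbert_space \<Rightarrow>\<^sub>L 'h) set" where
  "compact_operators = {T. (\<forall>c \<xi>. blinfun_apply T (c *\<^sub>C \<xi>) = c *\<^sub>C blinfun_apply T \<xi>) \<and>
     compact (closure (blinfun_apply T ` cball 0 1))}"

text \<open>\<open>is_adjoint S T\<close> says that \<open>S = T\<^sup>*\<close>; the adjoint is unique, so no choice is involved.\<close>

definition is_adjoint :: "('h::chilbert_space \<Rightarrow>\<^sub>L 'h) \<Rightarrow> ('h \<Rightarrow>\<^sub>L 'h) \<Rightarrow> bool" where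
  "is_adjoint S T \<longleftrightarrow>
     (\<forall>\<xi> \<eta>. cinner (blinfun_apply T \<xi>) \<eta> = cinner \<xi> (blinfun_apply S \<eta>))"

definition positive_operator :: "('h::chilbert_space \<Rightarrow>\<^sub>L 'h) \<Rightarrow> bool" where
  "positive_operator T \<longleftrightarrow> (\<forall>\<xi>. cinner (blinfun_apply T \<xi>) \<xi> \<in> \<real>\<^sub>\<ge>\<^sub>0)"

definition is_eigenvalue :: "complex \<Rightarrow> ('h::chilbert_space \<Rightarrow>\<^sub>L 'h) \<Rightarrow> bool" where
  "is_eigenvalue \<mu> T \<longleftrightarrow> (\<exists>\<xi>. \<xi> \<noteq> 0 \<and> blinfun_apply T \<xi> = \<mu> *\<^sub>C \<xi>)"

text \<open>Left Hilbert modules over the compact operators on \<open>'h\<close>. The norm of the module is the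
  class norm of \<open>'e\<close>, tied to the inner product by \<open>norm_eq\<close>, so that the class \<open>cbanach\<close> gives
  completeness. The values of \<open>act\<close> outside \<open>compact_operators\<close> are irrelevant.\<close>

locale hilbert_compact_module =
  fixes act :: "('h::chilbert_space \<Rightarrow>\<^sub>L 'h) \<Rightarrow> 'e::cbanach \<Rightarrow> 'e"
    and ip :: "'e \<Rightarrow> 'e \<Rightarrow> ('h \<Rightarrow>\<^sub>L 'h)"
  assumes act_add_left:
      "\<lbrakk>s \<in> compact_operators; t \<in> compact_operators\<rbrakk> \<Longrightarrow> act (s + t) x = act s x + act t x"
    and act_add_right: "t \<in> compact_operators \<Longrightarrow> act t (x + y) = act t x + act t y"
    and act_compose:
      "\<lbrakk>s \<in> compact_operators; t \<in> compact_operators\<rbrakk> \<Longrightarrow> act (s o\<^sub>L t) x = act s (act t x)"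
    and act_scaleC_left: "t \<in> compact_operators \<Longrightarrow> act (c *\<^sub>C t) x = c *\<^sub>C act t x"
    and act_scaleC_right: "t \<in> compact_operators \<Longrightarrow> act t (c *\<^sub>C x) = c *\<^sub>C act t x"
    and ip_compact: "ip x y \<in> compact_operators"
    and ip_add_left: "ip (x + y) z = ip x z + ip y z"
    and ip_scaleC_left: "ip (c *\<^sub>C x) y = c *\<^sub>C ip x y"
    and ip_add_right: "ip x (y + z) = ip x y + ip x z"
    and ip_scaleC_right: "ip x (c *\<^sub>C y) = cnj c *\<^sub>C ip x y"
    and ip_act_left: "t \<in> compact_operators \<Longrightarrow> ip (act t x) y = t o\<^sub>L ip x y"
    and ip_adjoint: "is_adjoint (ip y x) (ip x y)"
    and ip_positive: "positive_operator (ip x x)"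
    and ip_eq_zero_iff: "ip x x = 0 \<longleftrightarrow> x = 0"
    and norm_eq: "norm x = sqrt (norm (ip x x))"

end

theory Submission
  imports Defs
begin

text \<open>Write \<open>S = \<langle>x, y\<rangle>\<close> and \<open>q u \<xi> = [\<langle>u, u\<rangle> \<xi>, \<xi>]\<close> (\<open>quad\<close> below), and let
  \<open>\<bar>c\<bar> = 1\<close>. Everything rests on the module form of the
  Cauchy--Schwarz inequality (\<open>norm_ip_apply_le\<close>),
  \<open>\<parallel>\<langle>u, v\<rangle> \<xi>\<parallel>\<^sup>2 \<le> \<parallel>u\<parallel>\<^sup>2 q v \<xi> \<le> \<parallel>u\<parallel>\<^sup>2 \<parallel>v\<parallel>\<^sup>2 \<parallel>\<xi>\<parallel>\<^sup>2\<close>,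
  together with the expansion \<open>q (x + c y) \<xi> = q x \<xi> + 2 Re (cnj c [S \<xi>, \<xi>]) + q y \<xi>\<close>.
  If \<open>x\<close> or \<open>y\<close> vanishes, then \<open>S = 0\<close>, and both statements hold because the Hilbert space
  is nonzero; so let both be nonzero.

  If \<open>S \<xi> = c \<parallel>x\<parallel> \<parallel>y\<parallel> \<xi>\<close> for a unit vector \<open>\<xi>\<close>, then equality must hold throughout Cauchy--Schwarz,
  so \<open>q x \<xi> = \<parallel>x\<parallel>\<^sup>2\<close> and \<open>q y \<xi> = \<parallel>y\<parallel>\<^sup>2\<close>, the expansion equals \<open>(\<parallel>x\<parallel> + \<parallel>y\<parallel>)\<^sup>2\<close>, and it is a lower bound
  for \<open>\<parallel>x + c y\<parallel>\<^sup>2\<close>.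

  Conversely, if \<open>z = x + c y\<close> has norm \<open>\<parallel>x\<parallel> + \<parallel>y\<parallel>\<close>, pick unit vectors \<open>\<xi>\<^sub>n\<close> along which
  \<open>\<parallel>\<langle>z, z\<rangle> \<xi>\<^sub>n\<parallel>\<close> tends to \<open>\<parallel>z\<parallel>\<^sup>2\<close>. Cauchy--Schwarz with \<open>u = v = z\<close> gives \<open>q z \<xi>\<^sub>n \<longlonglongrightarrow> \<parallel>z\<parallel>\<^sup>2\<close>, and the
  expansion forces \<open>Re (cnj c [S \<xi>\<^sub>n, \<xi>\<^sub>n])\<close> up to \<open>\<parallel>x\<parallel> \<parallel>y\<parallel>\<close>. As \<open>\<parallel>S\<parallel> \<le> \<parallel>x\<parallel> \<parallel>y\<parallel>\<close>, the \<open>\<xi>\<^sub>n\<close> are approximate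
  eigenvectors of \<open>S\<close> for \<open>c \<parallel>x\<parallel> \<parallel>y\<parallel>\<close>, and compactness of \<open>S\<close> turns them into an eigenvector
  (\<open>compact_approximate_eigenvalue\<close>).\<close>

section \<open>Complex inner product spaces\<close>

lemma scaleC_zero_right [simp]: "c *\<^sub>C (0::'a::complex_vector) = 0"
  using scaleC_add_right[of c 0 0] by simp

lemma scaleC_zero_left [simp]: "0 *\<^sub>C (a::'a::complex_vector) = 0"
  using scaleC_add_left[of 0 0 a] by simp

lemma scaleC_minus_left: "(- c) *\<^sub>C (a::'a::complex_vector) = - (c *\<^sub>C a)"
  using scaleC_add_left[of c "- c" a] by (simp add: eq_neg_iff_add_eq_0 add.commute)

lemma cinner_add_right: "cinner (a::'a::complex_inner) (b + d) = cinner a b + cinner a d"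
  by (subst (1 2 3) cinner_commute) (simp add: cinner_add_left)

lemma cinner_scaleC_right: "cinner (a::'a::complex_inner) (c *\<^sub>C b) = cnj c * cinner a b"
  by (subst (1 2) cinner_commute) (simp add: cinner_scaleC_left)

lemma cinner_self: "cinner (a::'a::complex_inner) a = complex_of_real ((norm a)\<^sup>2)"
  using cinner_nonneg[of a] norm_eq_sqrt_cinner[of a]
  by (auto simp: complex_nonneg_Reals_iff complex_eq_iff)

lemma norm_add_square:
  "(norm (a + b))\<^sup>2 = (norm a)\<^sup>2 + (norm b)\<^sup>2 + 2 * Re (cinner (a::'a::complex_inner) b)"
proof -
  have "complex_of_real ((norm (a + b))\<^sup>2) = cinner (a + b) (a + b)"
    by (simp only: cinner_self)
  also have "\<dots> = complex_of_real ((norm a)\<^sup>2) + complex_of_real ((norm b)\<^sup>2)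
      + (cinner a b + cnj (cinner a b))"
    by (simp only: cinner_add_left cinner_add_right cinner_self[of a] cinner_self[of b]
        cinner_commute[of b a])
      (simp add: algebra_simps)
  finally have "Re (complex_of_real ((norm (a + b))\<^sup>2)) = Re \<dots>" by simp
  then show ?thesis by simp
qed

text \<open>The triangle inequality belongs to the normed space structure, so Cauchy--Schwarz can be read
  off from it instead of the other way round. The real part suffices because a unimodular factor
  can always be moved into one of the vectors.\<close>

lemma Re_cinner_le: "Re (cinner (a::'a::complex_inner) b) \<le> norm a * norm b"
proof -
  have "(norm (a + b))\<^sup>2 \<le> (norm a + norm b)\<^sup>2"
    by (intro power_mono norm_triangle_ineq) simp
  then show ?thesis
    by (simp add: norm_add_square power2_sum)
qed

section \<open>Compact operators\<close>

lemma blinfun_almost_norming_unit_vector: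
  fixes T :: "'a::real_normed_vector \<Rightarrow>\<^sub>L 'b::real_normed_vector"
  assumes "T \<noteq> 0" "e > 0"
  obtains \<xi> where "norm \<xi> = 1" "norm T - e < norm (T \<xi>)"
proof -
  have "\<exists>\<xi>. norm \<xi> = 1 \<and> norm T - e < norm (T \<xi>)"
  proof (rule ccontr)
    assume none: "\<not> ?thesis"
    define K where "K = max 0 (norm T - e)"
    have "norm (T \<xi>) \<le> K * norm \<xi>" for \<xi>
    proof (cases "\<xi> = 0")
      case False
      then have "norm (\<xi> /\<^sub>R norm \<xi>) = 1" by simp
      then have "norm (T (\<xi> /\<^sub>R norm \<xi>)) \<le> norm T - e"
        using none not_less by blast
      then have "norm (T (\<xi> /\<^sub>R norm \<xi>)) \<le> K" by (simp add: K_def)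
      with False show ?thesis
        by (simp add: blinfun.scaleR_right field_simps)
    qed simp
    then have "norm T \<le> K"
      by (intro norm_blinfun_bound) (auto simp: K_def)
    with assms show False by (auto simp: K_def max_def split: if_splits)
  qed
  then show thesis using that by blast
qed

text \<open>A nonzero approximate eigenvalue of a compact operator \<open>S\<close> is an eigenvalue: some subsequence of
  \<open>S \<xi>\<^sub>n\<close> converges, and \<open>\<mu> \<xi>\<^sub>n\<close> has the same limit, so \<open>\<xi>\<^sub>n\<close> converges too.\<close>

lemma compact_approximate_eigenvalue:
  fixes S :: "'h::chilbert_space \<Rightarrow>\<^sub>L 'h" and \<xi> :: "nat \<Rightarrow> 'h"
  assumes S: "S \<in> compact_operators" and \<mu>: "\<mu> \<noteq> 0"
    and unit: "\<And>n. norm (\<xi> n) = 1"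
    and approx: "(\<lambda>n. S (\<xi> n) - \<mu> *\<^sub>C \<xi> n) \<longlonglongrightarrow> 0"
  shows "is_eigenvalue \<mu> S"
proof -
  have "compact (closure (S ` cball 0 1))"
    using S by (simp add: compact_operators_def)
  moreover have "S (\<xi> n) \<in> closure (S ` cball 0 1)" for n
    by (rule subsetD[OF closure_subset]) (simp add: unit)
  ultimately obtain \<eta> r where r: "strict_mono (r::nat \<Rightarrow> nat)"
    and "(\<lambda>n. S (\<xi> (r n))) \<longlonglongrightarrow> \<eta>"
    unfolding compact_def by (fastforce simp: o_def)
  moreover have "(\<lambda>n. S (\<xi> (r n)) - \<mu> *\<^sub>C \<xi> (r n)) \<longlonglongrightarrow> 0"
    using LIMSEQ_subseq_LIMSEQ[OF approx r] by (simp add: o_def)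
  ultimately have "(\<lambda>n. \<mu> *\<^sub>C \<xi> (r n)) \<longlonglongrightarrow> \<eta>"
    using tendsto_diff by fastforce
  then have "(\<lambda>n. inverse \<mu> *\<^sub>C \<mu> *\<^sub>C \<xi> (r n)) \<longlonglongrightarrow> inverse \<mu> *\<^sub>C \<eta>"
    by (rule bounded_linear.tendsto[OF bounded_linear_scaleC])
  then have lim: "(\<lambda>n. \<xi> (r n)) \<longlonglongrightarrow> inverse \<mu> *\<^sub>C \<eta>"
    using \<mu> by (simp add: scaleC_scaleC scaleC_one)
  from tendsto_norm[OF lim] have "norm (inverse \<mu> *\<^sub>C \<eta>) = 1"
    by (simp add: unit LIMSEQ_const_iff)
  moreover have "(\<lambda>n. S (\<xi> (r n))) \<longlonglongrightarrow> S (inverse \<mu> *\<^sub>C \<eta>)"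
    by (intro tendsto_intros lim)
  then have "S (inverse \<mu> *\<^sub>C \<eta>) = \<eta>"
    using \<open>(\<lambda>n. S (\<xi> (r n))) \<longlonglongrightarrow> \<eta>\<close> LIMSEQ_unique by blast
  then have "S (inverse \<mu> *\<^sub>C \<eta>) = \<mu> *\<^sub>C inverse \<mu> *\<^sub>C \<eta>"
    using \<mu> by (simp add: scaleC_scaleC scaleC_one)
  ultimately show ?thesis
    unfolding is_eigenvalue_def by (metis norm_zero zero_neq_one)
qed

section \<open>Cauchy--Schwarz in the module\<close>

context hilbert_compact_module
begin

definition quad :: "'e \<Rightarrow> 'h \<Rightarrow> real" where
  "quad u \<xi> = Re (cinner (ip u u \<xi>) \<xi>)"

lemma ip_swap: "cinner (ip u v \<xi>) \<eta> = cinner \<xi> (ip v u \<eta>)"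
  using ip_adjoint[of v u] by (simp add: is_adjoint_def)

lemma ip_zero_left [simp]: "ip 0 v = 0"
  using ip_add_left[of 0 0 v] by simp

lemma norm_square: "(norm u)\<^sup>2 = norm (ip u u)"
  using norm_eq[of u] by simp

lemma quad_nonneg: "0 \<le> quad u \<xi>"
  using ip_positive[of u]
  by (auto simp: positive_operator_def quad_def complex_nonneg_Reals_iff)

lemma quad_le: "quad u \<xi> \<le> (norm u)\<^sup>2 * (norm \<xi>)\<^sup>2"
proof -
  have "quad u \<xi> \<le> norm (ip u u \<xi>) * norm \<xi>"
    unfolding quad_def by (rule Re_cinner_le)
  also have "\<dots> \<le> (norm (ip u u) * norm \<xi>) * norm \<xi>"
    by (intro mult_right_mono norm_blinfun) simp
  finally show ?thesis by (simp only: norm_square power2_eq_square[of "norm \<xi>"] mult.assoc)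
qed

lemma quad_add:
  "quad (u + c *\<^sub>C v) \<xi>
    = quad u \<xi> + (cmod c)\<^sup>2 * quad v \<xi> + 2 * Re (cnj c * cinner (ip u v \<xi>) \<xi>)"
proof -
  have vu: "cinner (ip v u \<xi>) \<xi> = cnj (cinner (ip u v \<xi>) \<xi>)"
    by (metis ip_swap cinner_commute)
  have cc: "c * (cnj c * w) = complex_of_real ((cmod c)\<^sup>2) * w" for w
    by (metis complex_norm_square mult.assoc)
  have "cinner (ip (u + c *\<^sub>C v) (u + c *\<^sub>C v) \<xi>) \<xi>
      = cinner (ip u u \<xi>) \<xi> + cnj c * cinner (ip u v \<xi>) \<xi>
        + (c * cinner (ip v u \<xi>) \<xi> + c * (cnj c * cinner (ip v v \<xi>) \<xi>))"
    by (simp add: ip_add_left ip_add_right ip_scaleC_left ip_scaleC_right blinfun.add_left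
        scaleC_blinfun.rep_eq cinner_add_left cinner_scaleC_left algebra_simps)
  also have "\<dots> = cinner (ip u u \<xi>) \<xi> + (cnj c * cinner (ip u v \<xi>) \<xi>
        + cnj (cnj c * cinner (ip u v \<xi>) \<xi>))
        + complex_of_real ((cmod c)\<^sup>2) * cinner (ip v v \<xi>) \<xi>"
    by (simp only: cc vu) simp
  finally show ?thesis unfolding quad_def by simp
qed

text \<open>The proof is the classical one, applied to the vector \<open>v - \<parallel>u\<parallel>\<^sup>-\<^sup>2 \<langle>v, u\<rangle> u\<close>. Its form at \<open>\<xi>\<close> is
  \<open>q v \<xi> - 2 \<parallel>u\<parallel>\<^sup>-\<^sup>2 \<parallel>\<langle>u, v\<rangle> \<xi>\<parallel>\<^sup>2 + \<parallel>u\<parallel>\<^sup>-\<^sup>4 q u (\<langle>u, v\<rangle> \<xi>)\<close>, nonnegative by positivity; the last term is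
  at most \<open>\<parallel>u\<parallel>\<^sup>-\<^sup>2 \<parallel>\<langle>u, v\<rangle> \<xi>\<parallel>\<^sup>2\<close> by \<open>quad_le\<close>. The vector \<open>\<xi>\<close> is kept on the right, rather than
  passing to operator norms, because the equality analysis needs \<open>q v \<xi>\<close> itself.\<close>

lemma norm_ip_apply_le: "(norm (ip u v \<xi>))\<^sup>2 \<le> (norm u)\<^sup>2 * quad v \<xi>"
proof (cases "u = 0")
  case False
  define R where "R = ip v u"
  define \<eta> where "\<eta> = ip u v \<xi>"
  define a where "a = 1 / (norm u)\<^sup>2"
  have a: "a > 0" "a * (norm u)\<^sup>2 = 1" using False by (auto simp: a_def)
  have R: "R \<in> compact_operators" unfolding R_def by (rule ip_compact)
  have R_swap: "cinner (R \<zeta>) \<xi> = cinner \<zeta> \<eta>" for \<zeta>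
    by (simp add: R_def \<eta>_def ip_swap)
  have act_ip: "ip (act R u) w \<zeta> = R (ip u w \<zeta>)" for w \<zeta>
    by (simp add: ip_act_left[OF R])
  have "cinner (ip (act R u) v \<xi>) \<xi> = complex_of_real ((norm \<eta>)\<^sup>2)"
    by (simp add: act_ip R_swap cinner_self flip: \<eta>_def)
  then have cross: "cinner (ip v (act R u) \<xi>) \<xi> = complex_of_real ((norm \<eta>)\<^sup>2)"
    by (metis ip_swap cinner_commute complex_cnj_complex_of_real)
  have "cinner (ip (act R u) (act R u) \<xi>) \<xi> = cinner (ip u (act R u) \<xi>) \<eta>"
    by (simp add: act_ip R_swap)
  also have "\<dots> = cinner \<xi> (R (ip u u \<eta>))"
    by (simp add: ip_swap act_ip)
  also have "\<dots> = cnj (cinner (ip u u \<eta>) \<eta>)"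
    by (metis R_swap cinner_commute)
  finally have "quad (act R u) \<xi> = quad u \<eta>" by (simp add: quad_def)
  moreover have "quad u \<eta> \<le> (norm u)\<^sup>2 * (norm \<eta>)\<^sup>2" by (rule quad_le)
  ultimately have "a\<^sup>2 * quad (act R u) \<xi> \<le> a\<^sup>2 * ((norm u)\<^sup>2 * (norm \<eta>)\<^sup>2)"
    by (intro mult_left_mono) auto
  also have "\<dots> = a * (a * (norm u)\<^sup>2) * (norm \<eta>)\<^sup>2" by (simp add: power2_eq_square)
  finally have "a\<^sup>2 * quad (act R u) \<xi> \<le> a * (norm \<eta>)\<^sup>2" using a by simp
  moreover have "0 \<le> quad (v + complex_of_real (- a) *\<^sub>C act R u) \<xi>" by (rule quad_nonneg)
  then have "0 \<le> quad v \<xi> + a\<^sup>2 * quad (act R u) \<xi> - 2 * (a * (norm \<eta>)\<^sup>2)"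
    unfolding quad_add cross by simp
  ultimately have "a * (norm \<eta>)\<^sup>2 \<le> quad v \<xi>" by linarith
  then show ?thesis using False by (simp add: a_def \<eta>_def field_simps)
qed simp

lemma norm_ip_apply_le_norms: "norm (ip u v \<xi>) \<le> norm u * norm v * norm \<xi>"
proof -
  have "(norm (ip u v \<xi>))\<^sup>2 \<le> (norm u)\<^sup>2 * ((norm v)\<^sup>2 * (norm \<xi>)\<^sup>2)"
    by (rule order_trans[OF norm_ip_apply_le mult_left_mono[OF quad_le]]) simp
  then have "(norm (ip u v \<xi>))\<^sup>2 \<le> (norm u * norm v * norm \<xi>)\<^sup>2"
    by (simp add: power_mult_distrib mult.assoc)
  then show ?thesis by (rule power2_le_imp_le) simp
qed

section \<open>Parallelism and eigenvalues\<close>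

lemma norm_parallel_if_eigenvalue:
  assumes c: "cmod c = 1"
    and ev: "is_eigenvalue (c * complex_of_real (norm x * norm y)) (ip x y)"
  shows "norm (x + c *\<^sub>C y) = norm x + norm y"
proof (cases "x = 0 \<or> y = 0")
  case True
  then show ?thesis using c by (auto simp: norm_scaleC)
next
  case False
  define p where "p = norm x * norm y"
  have p: "p > 0" using False by (simp add: p_def)
  obtain \<xi>\<^sub>0 where \<xi>\<^sub>0: "\<xi>\<^sub>0 \<noteq> 0" "ip x y \<xi>\<^sub>0 = (c * complex_of_real p) *\<^sub>C \<xi>\<^sub>0"
    using ev unfolding is_eigenvalue_def p_def by blast
  define \<xi> where "\<xi> = \<xi>\<^sub>0 /\<^sub>R norm \<xi>\<^sub>0"
  have unit: "norm \<xi> = 1" using \<xi>\<^sub>0 by (simp add: \<xi>_def)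
  have "ip x y \<xi> = ip x y \<xi>\<^sub>0 /\<^sub>R norm \<xi>\<^sub>0" by (simp only: \<xi>_def blinfun.scaleR_right)
  then have eig: "ip x y \<xi> = (c * complex_of_real p) *\<^sub>C \<xi>"
    by (simp add: \<xi>\<^sub>0(2) \<xi>_def scaleR_scaleC scaleC_scaleC mult.commute)
  have "cnj c * c = 1" using c complex_norm_square[of c]
    by (metis mult.commute of_real_1 power_one)
  then have inner: "cnj c * cinner (ip x y \<xi>) \<xi> = complex_of_real p"
    by (simp add: eig cinner_scaleC_left cinner_self unit)
  have "norm (ip x y \<xi>) = p" using p c by (simp add: eig norm_scaleC norm_mult unit)
  with norm_ip_apply_le[of x y \<xi>] have qy: "(norm y)\<^sup>2 \<le> quad y \<xi>"
    using False by (simp add: p_def power_mult_distrib)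
  \<comment> \<open>The eigenvector equation controls \<open>S\<close>; the adjoint \<open>\<langle>y, x\<rangle>\<close> is large at \<open>\<xi>\<close> because its
    matrix coefficient there is the conjugate of the one of \<open>S\<close>.\<close>
  have "p = Re (cinner (cnj c *\<^sub>C \<xi>) (ip y x \<xi>))"
    using inner by (simp add: cinner_scaleC_left ip_swap)
  also have "\<dots> \<le> norm (cnj c *\<^sub>C \<xi>) * norm (ip y x \<xi>)" by (rule Re_cinner_le)
  finally have "p \<le> norm (ip y x \<xi>)" using c by (simp add: norm_scaleC unit)
  then have "p\<^sup>2 \<le> (norm (ip y x \<xi>))\<^sup>2" using p by (intro power_mono) auto
  also have "\<dots> \<le> (norm y)\<^sup>2 * quad x \<xi>" by (rule norm_ip_apply_le)
  finally have qx: "(norm x)\<^sup>2 \<le> quad x \<xi>"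
    using False by (simp add: p_def power_mult_distrib mult.commute)
  have "(norm x + norm y)\<^sup>2 = (norm x)\<^sup>2 + (norm y)\<^sup>2 + 2 * p"
    by (simp add: p_def power2_sum)
  also have "\<dots> \<le> quad (x + c *\<^sub>C y) \<xi>"
    unfolding quad_add inner using qx qy c by simp
  also have "\<dots> \<le> (norm (x + c *\<^sub>C y))\<^sup>2" using quad_le[of "x + c *\<^sub>C y" \<xi>] unit by simp
  finally have "norm x + norm y \<le> norm (x + c *\<^sub>C y)" by (rule power2_le_imp_le) simp
  moreover have "norm (x + c *\<^sub>C y) \<le> norm x + norm y"
    using norm_triangle_ineq[of x "c *\<^sub>C y"] c by (simp add: norm_scaleC)
  ultimately show ?thesis by simp
qed

text \<open>This makes the converse quantitative: where the form of \<open>x + c y\<close> comes close to its maximal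
  value, the cross term comes close to \<open>\<parallel>x\<parallel> \<parallel>y\<parallel>\<close>. A vector \<open>S \<xi>\<close> of norm at most \<open>\<parallel>x\<parallel> \<parallel>y\<parallel>\<close> whose
  component along \<open>c \<xi>\<close> is nearly that large has to be close to \<open>c \<parallel>x\<parallel> \<parallel>y\<parallel> \<xi>\<close>.\<close>

lemma eigenvector_defect_le:
  assumes c: "cmod c = 1" and unit: "norm \<xi> = 1"
  shows "(norm (ip x y \<xi> - (c * complex_of_real (norm x * norm y)) *\<^sub>C \<xi>))\<^sup>2
    \<le> norm x * norm y * ((norm x + norm y)\<^sup>2 - quad (x + c *\<^sub>C y) \<xi>)"
proof -
  define p where "p = norm x * norm y"
  define \<mu> where "\<mu> = - (c * complex_of_real p)"
  define t where "t = Re (cnj c * cinner (ip x y \<xi>) \<xi>)"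
  have p: "p \<ge> 0" by (simp add: p_def)
  have diff: "ip x y \<xi> - (c * complex_of_real p) *\<^sub>C \<xi> = ip x y \<xi> + \<mu> *\<^sub>C \<xi>"
    by (simp add: \<mu>_def scaleC_minus_left)
  have "norm (ip x y \<xi>) \<le> p"
    using norm_ip_apply_le_norms[of x y \<xi>] by (simp add: p_def unit)
  then have "(norm (ip x y \<xi>))\<^sup>2 \<le> p\<^sup>2" by (intro power_mono) auto
  moreover have "(norm (ip x y \<xi> + \<mu> *\<^sub>C \<xi>))\<^sup>2 = (norm (ip x y \<xi>))\<^sup>2 + p\<^sup>2 - 2 * (p * t)"
    using c by (simp add: norm_add_square norm_scaleC norm_mult unit \<mu>_def
        cinner_scaleC_right t_def algebra_simps)
  ultimately have "(norm (ip x y \<xi> + \<mu> *\<^sub>C \<xi>))\<^sup>2 \<le> p * (2 * p - 2 * t)"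
    by (simp add: power2_eq_square algebra_simps)
  also have "\<dots> \<le> p * ((norm x + norm y)\<^sup>2 - quad (x + c *\<^sub>C y) \<xi>)"
  proof (rule mult_left_mono[OF _ p])
    show "2 * p - 2 * t \<le> (norm x + norm y)\<^sup>2 - quad (x + c *\<^sub>C y) \<xi>"
      using quad_le[of x \<xi>] quad_le[of y \<xi>] c unit
      by (simp add: quad_add t_def p_def power2_sum)
  qed
  finally show ?thesis unfolding diff[symmetric] by (simp add: p_def)
qed

lemma eigenvalue_if_norm_parallel:
  assumes H: "\<exists>\<xi>::'h. \<xi> \<noteq> 0" and c: "cmod c = 1"
    and par: "norm (x + c *\<^sub>C y) = norm x + norm y"
  shows "is_eigenvalue (c * complex_of_real (norm x * norm y)) (ip x y)"
proof (cases "norm x * norm y = 0")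
  case True
  then have "ip x y \<xi> = 0" for \<xi> using norm_ip_apply_le_norms[of x y \<xi>] by auto
  then show ?thesis using H True by (auto simp: is_eigenvalue_def)
next
  case False
  define \<mu> where "\<mu> = c * complex_of_real (norm x * norm y)"
  define z where "z = x + c *\<^sub>C y"
  define M where "M = (norm z)\<^sup>2"
  have M: "M = norm (ip z z)" by (simp add: M_def norm_square)
  have z: "norm z > 0" using False par by (auto simp: z_def add_pos_pos)
  then have "M > 0" by (simp add: M_def)
  then have "ip z z \<noteq> 0" using M by auto
  then have "\<exists>\<xi>. norm \<xi> = 1 \<and> M - inverse (real (Suc n)) < norm (ip z z \<xi>)" for n
    using blinfun_almost_norming_unit_vector[of "ip z z" "inverse (real (Suc n))"] M
    by (metis inverse_positive_iff_positive of_nat_0_less_iff zero_less_Suc)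
  then obtain \<xi> where unit: "\<And>n. norm (\<xi> n) = 1"
    and lower: "\<And>n. M - inverse (real (Suc n)) < norm (ip z z (\<xi> n))"
    by metis
  have upper: "norm (ip z z (\<xi> n)) \<le> M" for n
    using norm_blinfun[of "ip z z" "\<xi> n"] by (simp add: M unit)
  have "(\<lambda>n. M - inverse (real (Suc n))) \<longlonglongrightarrow> M - 0"
    by (intro tendsto_diff tendsto_const LIMSEQ_inverse_real_of_nat)
  then have "(\<lambda>n. M - inverse (real (Suc n))) \<longlonglongrightarrow> M" by simp
  from real_tendsto_sandwich[OF _ _ this tendsto_const]
  have lim: "(\<lambda>n. norm (ip z z (\<xi> n))) \<longlonglongrightarrow> M"
    using lower upper less_imp_le by (meson always_eventually)
  \<comment> \<open>The defect bound, with the form of \<open>z\<close> replaced by its lower bound \<open>\<parallel>\<langle>z, z\<rangle> \<xi>\<^sub>n\<parallel>\<^sup>2 / \<parallel>z\<parallel>\<^sup>2\<close>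
    from Cauchy--Schwarz for \<open>z\<close> with itself.\<close>
  define d where "d n = norm x * norm y * (M - (norm (ip z z (\<xi> n)))\<^sup>2 / M)" for n
  have "d \<longlonglongrightarrow> norm x * norm y * (M - M\<^sup>2 / M)"
    unfolding d_def using \<open>M > 0\<close> by (intro tendsto_intros lim) auto
  then have d: "d \<longlonglongrightarrow> 0" using \<open>M > 0\<close> by (simp add: power2_eq_square)
  have "(norm (ip x y (\<xi> n) - \<mu> *\<^sub>C \<xi> n))\<^sup>2 \<le> d n" for n
  proof -
    have "(norm (ip z z (\<xi> n)))\<^sup>2 / M \<le> quad z (\<xi> n)"
      using norm_ip_apply_le[of z z "\<xi> n"] \<open>M > 0\<close>
      by (simp add: M_def divide_le_eq mult.commute)
    then have "norm x * norm y * (M - quad z (\<xi> n)) \<le> d n"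
      unfolding d_def by (intro mult_left_mono) auto
    then show ?thesis
      using eigenvector_defect_le[OF c unit, of x y n] par by (simp add: \<mu>_def M_def z_def)
  qed
  then have "(\<lambda>n. (norm (ip x y (\<xi> n) - \<mu> *\<^sub>C \<xi> n))\<^sup>2) \<longlonglongrightarrow> 0"
    using real_tendsto_sandwich[OF _ _ tendsto_const d] zero_le_power2
    by (meson always_eventually)
  then have "(\<lambda>n. sqrt ((norm (ip x y (\<xi> n) - \<mu> *\<^sub>C \<xi> n))\<^sup>2)) \<longlonglongrightarrow> sqrt 0"
    by (rule tendsto_real_sqrt)
  then have approx: "(\<lambda>n. ip x y (\<xi> n) - \<mu> *\<^sub>C \<xi> n) \<longlonglongrightarrow> 0"
    by (simp add: tendsto_norm_zero_iff)
  have "\<mu> \<noteq> 0" using False c by (auto simp: \<mu>_def)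
  from compact_approximate_eigenvalue[OF ip_compact this unit approx]
  show ?thesis unfolding \<mu>_def .
qed

end

theorem proposition2p2:
  fixes act :: "('h::chilbert_space \<Rightarrow>\<^sub>L 'h) \<Rightarrow> 'e::cbanach \<Rightarrow> 'e"
    and ip :: "'e \<Rightarrow> 'e \<Rightarrow> ('h \<Rightarrow>\<^sub>L 'h)"
    and x y :: 'e
  assumes "\<exists>\<xi>::'h. \<xi> \<noteq> 0"
    and "hilbert_compact_module act ip"
  shows "norm_parallel x y \<longleftrightarrow>
    (\<exists>c. cmod c = 1 \<and> is_eigenvalue (c * complex_of_real (norm x * norm y)) (ip x y))"
proof -
  interpret hilbert_compact_module act ip by fact
  show ?thesis
    unfolding norm_parallel_def
    using norm_parallel_if_eigenvalue eigenvalue_if_norm_parallel[OF assms(1)] by metis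
qed

end
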